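(* Let $t\le k$ be positive integers and $n,s\ge0$ integers. The number of words $\pi\in[k]^n$ with $\mathrm{lev}_{[t]}(\pi)=s$ (i.e., with exactly $s$ levels whose first element lies in $[t]$) equals $$\sum_{m=0}^n\sum_{i=0}^m(-1)^{n-m-s}\binom{m}{i}\binom{i+n-m-1}{n-m}\binom{n-m}{s}(k-t)^{m-i}t^i.$$
   Context: $[k]=\{1,\ldots,k\}$, $[k]^n$ is the set of words of length $n$ over $[k]$. For a word $\pi=\pi_1\cdots\pi_n$ and $X\subseteq\mathbb{N}$, $\mathrm{lev}_X(\pi)=|\{i:\pi_i=\pi_{i+1},\ \pi_i\in X\}|$. Conventions: $\binom{a}{b}=\frac{a(a-1)\cdots(a-b+1)}{b!}$ for integers $b\ge0$ (so $\binom{-1}{0}=1$), $\binom{a}{b}=0$ for $b<0$, and $0^0=1$. *)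

theory Defs
  imports Complex_Main
begin

definition words :: "nat \<Rightarrow> nat \<Rightarrow> nat list set" where
  "words k n = {w. length w = n \<and> set w \<subseteq> {1..k}}"

text \<open>List positions are counted from 0.\<close>

definition lev :: "nat set \<Rightarrow> nat list \<Rightarrow> nat" where
  "lev X w = card {i. i + 1 < length w \<and> w ! i = w ! (i + 1) \<and> w ! i \<in> X}"

end

theory Submission
  imports Defs "HOL-Computational_Algebra.Formal_Power_Series"
begin

text \<open>
  Weight a word \<open>w\<close> by \<open>q ^ lev X w\<close>, where \<open>X = {1..t}\<close>, and put \<open>y = q - 1\<close>. Writing the
  weight of each level as \<open>1 + y\<close> amounts to marking a subset of the levels with weight \<open>y\<close>. A word
  with marked levels is a sequence of \<open>m\<close> blocks, each of which is either a single letter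
  outside \<open>X\<close> or a run of a letter of \<open>X\<close> all of whose levels are marked. So the generating
  function in the length \<open>x\<close> is the sum over \<open>m\<close> of \<open>x ^ m * (k - t + t / (1 - y * x)) ^ m\<close>.
  Expanding this by the binomial theorem, and then \<open>y ^ (n - m) = (q - 1) ^ (n - m)\<close> in powers
  of \<open>q\<close>, gives the formula. The block decomposition is verified through a linear recurrence
  satisfied by the weighted count of all words together with that of the words starting in \<open>X\<close>.
\<close>

unbundle fps_syntax

section \<open>Levels and sums over words under prepending a letter\<close>

lemma lev_Nil [simp]: "lev X [] = 0"
  by (simp add: lev_def)

lemma lev_Cons:
  "lev X (c # w) = (if w \<noteq> [] \<and> hd w = c \<and> c \<in> X then 1 else 0) + lev X w"
proof -
  let ?S = "{i. i + 1 < length w \<and> w ! i = w ! (i + 1) \<and> w ! i \<in> X}"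
  let ?A = "if w \<noteq> [] \<and> hd w = c \<and> c \<in> X then {0} else ({} :: nat set)"
  have "{i. i + 1 < length (c # w) \<and> (c # w) ! i = (c # w) ! (i + 1) \<and> (c # w) ! i \<in> X}
      = ?A \<union> Suc ` ?S" (is "?L = _")
  proof (rule set_eqI)
    fix i show "i \<in> ?L \<longleftrightarrow> i \<in> ?A \<union> Suc ` ?S"
      by (cases i) (auto simp: hd_conv_nth)
  qed
  moreover have "finite ?S" by (rule finite_subset[of _ "{..<length w}"]) auto
  ultimately show ?thesis
    unfolding lev_def by (simp add: card_image card_Un_disjoint)
qed

lemma lev_le_length: "lev X w \<le> length w"
  by (induction w) (auto simp: lev_Cons)

lemma finite_words [simp]: "finite (words k n)"
  using finite_lists_length_eq[of "{1..k}" n] by (simp add: words_def conj_commute)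

lemma words_0 [simp]: "words k 0 = {[]}"
  by (auto simp: words_def)

lemma sum_words_Suc:
  "(\<Sum>w\<in>words k (Suc n). f w) = (\<Sum>w\<in>words k n. \<Sum>c\<in>{1..k}. f (c # w))"
proof -
  have "words k (Suc n) = (\<lambda>(w, c). c # w) ` (words k n \<times> {1..k})"
    using lists_length_Suc_eq[of "{1..k}" n] by (simp add: words_def conj_commute)
  moreover have "inj_on (\<lambda>(w, c). c # w) (words k n \<times> {1..k})"
    by (auto simp: inj_on_def)
  ultimately show ?thesis
    by (simp add: sum.reindex sum.cartesian_product case_prod_unfold)
qed

section \<open>Weighted word counts and their coupled recurrence\<close>

definition lev_weight :: "nat set \<Rightarrow> nat \<Rightarrow> real \<Rightarrow> nat \<Rightarrow> real" where
  "lev_weight X k q n = (\<Sum>w\<in>words k n. q ^ lev X w)"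

definition lev_weight_hd :: "nat set \<Rightarrow> nat \<Rightarrow> real \<Rightarrow> nat \<Rightarrow> real" where
  "lev_weight_hd X k q n = (\<Sum>w\<in>words k n. if w \<noteq> [] \<and> hd w \<in> X then q ^ lev X w else 0)"

lemma lev_weight_0 [simp]: "lev_weight X k q 0 = 1" "lev_weight_hd X k q 0 = 0"
  by (simp_all add: lev_weight_def lev_weight_hd_def)

text \<open>Only the letter \<open>hd w\<close>, when it lies in \<open>X\<close>, creates a new
  level; its term exceeds the common value \<open>q ^ lev X w\<close> by the factor
  \<open>q\<close>, hence the correction with \<open>q - 1\<close>.\<close>

lemma sum_power_lev_Cons:
  assumes "finite X"
  shows "(\<Sum>c\<in>X. q ^ lev X (c # w)) =
    real (card X) * q ^ lev X w + (q - 1) * (if w \<noteq> [] \<and> hd w \<in> X then q ^ lev X w else 0)"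
proof -
  have "(\<Sum>c\<in>X. q ^ lev X (c # w)) =
    (\<Sum>c\<in>X. q ^ lev X w + (if c = hd w then if w \<noteq> [] then (q - 1) * q ^ lev X w else 0 else 0))"
    by (rule sum.cong) (auto simp: lev_Cons algebra_simps)
  then show ?thesis
    using assms by (simp add: sum.distrib)
qed

lemma lev_weight_hd_Suc:
  assumes "X \<subseteq> {1..k}"
  shows "lev_weight_hd X k q (Suc n) =
    real (card X) * lev_weight X k q n + (q - 1) * lev_weight_hd X k q n"
proof -
  have fin: "finite X" using assms finite_subset by blast
  have "lev_weight_hd X k q (Suc n) =
      (\<Sum>w\<in>words k n. \<Sum>c\<in>{1..k}. if c \<in> X then q ^ lev X (c # w) else 0)"
    by (simp add: lev_weight_hd_def sum_words_Suc)
  also have "\<dots> = (\<Sum>w\<in>words k n. \<Sum>c\<in>X. q ^ lev X (c # w))"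
    using assms by (simp add: sum.inter_restrict [symmetric] Int_absorb1)
  finally show ?thesis
    by (simp only: sum_power_lev_Cons[OF fin] sum.distrib sum_distrib_left
        lev_weight_def lev_weight_hd_def)
qed

text \<open>A first letter outside \<open>X\<close> never starts a counted level, so it leaves the
  weight unchanged.\<close>

lemma lev_weight_Suc:
  assumes "X \<subseteq> {1..k}"
  shows "lev_weight X k q (Suc n) =
    (real k - real (card X)) * lev_weight X k q n + lev_weight_hd X k q (Suc n)"
proof -
  have fin: "finite X" using assms finite_subset by blast
  have le: "card X \<le> k" using card_mono[OF _ assms] by simp
  have "(\<Sum>c\<in>{1..k}. q ^ lev X (c # w)) =
      (real k - real (card X)) * q ^ lev X w
      + (\<Sum>c\<in>{1..k}. if c \<in> X then q ^ lev X (c # w) else 0)" for w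
  proof -
    have "(\<Sum>c\<in>{1..k}. q ^ lev X (c # w)) =
        (\<Sum>c\<in>{1..k} - X. q ^ lev X (c # w)) + (\<Sum>c\<in>X. q ^ lev X (c # w))"
      using assms by (simp add: sum.subset_diff)
    also have "(\<Sum>c\<in>{1..k} - X. q ^ lev X (c # w)) = (\<Sum>c\<in>{1..k} - X. q ^ lev X w)"
      by (rule sum.cong) (auto simp: lev_Cons)
    also have "\<dots> = (real k - real (card X)) * q ^ lev X w"
      using assms fin le by (simp add: card_Diff_subset of_nat_diff)
    finally show ?thesis
      using assms by (simp add: sum.inter_restrict [symmetric] Int_absorb1)
  qed
  then show ?thesis
    by (simp add: lev_weight_def lev_weight_hd_def sum_words_Suc sum.distrib sum_distrib_left)
qed

section \<open>Power series of blocks\<close>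

lemma geometric_fps_nth_power:
  fixes y :: real
  shows "(Abs_fps (\<lambda>j. y ^ j) ^ i) $ j = ((real i + real j - 1) gchoose j) * y ^ j"
proof (induction i arbitrary: j)
  case 0
  show ?case
  proof (cases j)
    \<comment> \<open>Here the binomial is \<open>l\<close> over \<open>l + 1\<close>, which is 0;
      for \<open>j = 0\<close> it is -1 over 0, which is 1.\<close>
    case (Suc l)
    have "real j - 1 = real l" using Suc by simp
    then show ?thesis using Suc by (simp add: binomial_gbinomial [symmetric])
  qed simp
next
  case (Suc i)
  \<comment> \<open>One more geometric factor turns the coefficient into a parallel sum of
    binomials, since all powers of \<open>y\<close> merge into \<open>y ^ j\<close>.\<close>
  have "(Abs_fps (\<lambda>j. y ^ j) ^ Suc i) $ j =
      (\<Sum>l\<le>j. ((real i - 1 + real l) gchoose l) * y ^ l * y ^ (j - l))"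
    by (simp only: power_Suc2 fps_mult_nth Suc atMost_atLeast0 fps_nth_Abs_fps add_diff_eq diff_add_eq)
  also have "\<dots> = (\<Sum>l\<le>j. ((real i - 1 + real l) gchoose l) * y ^ j)"
    by (rule sum.cong) (simp_all add: mult.assoc power_add [symmetric])
  also have "\<dots> = ((real i - 1 + real j + 1) gchoose j) * y ^ j"
    by (simp only: sum_distrib_right [symmetric] gbinomial_parallel_sum)
  finally show ?case by (simp add: algebra_simps)
qed

text \<open>Generating function of one block with the factor \<open>x\<close> of its first letter
  removed, so the exponent counts marked levels.\<close>

definition block_fps :: "real \<Rightarrow> real \<Rightarrow> real \<Rightarrow> real fps" where
  "block_fps a b y = fps_const a + fps_const b * Abs_fps (\<lambda>j. y ^ j)"

lemma block_fps_power_nth: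
  "(block_fps a b y ^ m) $ j =
    (\<Sum>i\<le>m. (real m gchoose i) * ((real i + real j - 1) gchoose j) * a ^ (m - i) * b ^ i * y ^ j)"
proof -
  let ?g = "Abs_fps (\<lambda>j. y ^ j)"
  have "block_fps a b y ^ m = (\<Sum>i\<le>m. fps_const (real (m choose i) * b ^ i * a ^ (m - i)) * ?g ^ i)"
    unfolding block_fps_def add.commute[of "fps_const a"] binomial_ring
    by (rule sum.cong)
       (simp_all add: power_mult_distrib fps_const_mult [symmetric] fps_const_power [symmetric]
         fps_of_nat mult_ac del: fps_const_mult fps_const_power)
  then show ?thesis
    by (simp add: fps_sum_nth geometric_fps_nth_power binomial_gbinomial mult_ac)
qed

text \<open>The first letters of \<open>m\<close> blocks leave \<open>n - m\<close> letters, one for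
  each marked level. Both sides obey the same recurrence.\<close>

lemma lev_weight_eq_block_fps:
  fixes q :: real
  assumes "X \<subseteq> {1..k}"
  defines "b \<equiv> real (card X)"
  defines "u \<equiv> block_fps (real k - b) b (q - 1)"
  shows "lev_weight X k q n = (\<Sum>m\<le>n. (u ^ m) $ (n - m))"
proof -
  define v where "v = fps_const b * Abs_fps (\<lambda>j. (q - 1) ^ j)"
  have u: "u = fps_const (real k - b) + v"
    by (simp add: u_def v_def block_fps_def)
  \<comment> \<open>A run is a single letter or a shorter run extended by one marked level.\<close>
  have v: "v = fps_const b + fps_const (q - 1) * (fps_X * v)"
  proof (rule fps_ext)
    fix j show "v $ j = (fps_const b + fps_const (q - 1) * (fps_X * v)) $ j"
      by (cases j) (simp_all add: v_def)
  qed
  define R where "R n = (\<Sum>m\<le>n. (u ^ m) $ (n - m))" for n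
  \<comment> \<open>Counterpart of \<open>lev_weight_hd\<close>: the first block is a run, followed
    by \<open>m\<close> arbitrary blocks.\<close>
  define S where "S n = (\<Sum>m<n. (v * u ^ m) $ (n - 1 - m))" for n
  have S_Suc: "S (Suc n) = b * R n + (q - 1) * S n" for n
  proof -
    have "S (Suc n) = (\<Sum>m\<le>n. (v * u ^ m) $ (n - m))"
      by (simp add: S_def lessThan_Suc_atMost)
    also have "\<dots> = (\<Sum>m\<le>n. b * (u ^ m) $ (n - m) + (q - 1) * (fps_X * (v * u ^ m)) $ (n - m))"
    proof (rule sum.cong)
      fix m
      have "v * u ^ m = fps_const b * u ^ m + fps_const (q - 1) * (fps_X * (v * u ^ m))"
        by (subst v) (simp add: algebra_simps)
      then show "(v * u ^ m) $ (n - m) =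
          b * (u ^ m) $ (n - m) + (q - 1) * (fps_X * (v * u ^ m)) $ (n - m)"
        by (metis fps_add_nth fps_mult_left_const_nth)
    qed simp
    also have "\<dots> = b * R n + (q - 1) * (\<Sum>m\<le>n. (fps_X * (v * u ^ m)) $ (n - m))"
      by (simp only: R_def sum.distrib sum_distrib_left)
    \<comment> \<open>The term \<open>m = n\<close> vanishes because \<open>fps_X\<close> has
      constant coefficient 0.\<close>
    also have "(\<Sum>m\<le>n. (fps_X * (v * u ^ m)) $ (n - m)) = S n"
      by (simp add: S_def lessThan_Suc_atMost [symmetric] diff_commute)
    finally show ?thesis .
  qed
  have R_Suc: "R (Suc n) = (real k - b) * R n + S (Suc n)" for n
  proof -
    have "R (Suc n) = (\<Sum>m\<le>n. (u * u ^ m) $ (n - m))"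
      \<comment> \<open>The term \<open>m = 0\<close> is a positive-degree coefficient of 1, hence
        0.\<close>
      unfolding R_def by (subst sum.atMost_Suc_shift) simp
    also have "\<dots> = (real k - b) * R n + S (Suc n)"
      by (simp add: R_def S_def u distrib_right sum.distrib sum_distrib_left lessThan_Suc_atMost)
    finally show ?thesis .
  qed
  have "lev_weight X k q n = R n \<and> lev_weight_hd X k q n = S n"
  proof (induction n)
    case 0
    show ?case by (simp add: R_def S_def)
  next
    case (Suc n)
    then show ?case
      using assms(1)
      by (simp add: lev_weight_Suc lev_weight_hd_Suc R_Suc S_Suc b_def)
  qed
  then show ?thesis by (simp add: R_def)
qed

section \<open>Extraction of the coefficients of \<open>q\<close>\<close>

lemma lev_weight_eq_sum_card:
  "lev_weight X k q n = (\<Sum>s\<le>n. real (card {w \<in> words k n. lev X w = s}) * q ^ s)"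
proof -
  have "lev X ` words k n \<subseteq> {..n}"
    using lev_le_length by (auto simp: words_def)
  then have "lev_weight X k q n = (\<Sum>s\<le>n. \<Sum>w\<in>{w \<in> words k n. lev X w = s}. q ^ lev X w)"
    unfolding lev_weight_def by (intro sum.group [symmetric]) simp_all
  then show ?thesis by simp
qed

text \<open>Summing up to \<open>n\<close> makes the range independent of \<open>d\<close>, so sums
  can be swapped; the binomial is 0 for \<open>s > d\<close>, where the exponent of -1 is
  negative.\<close>

lemma minus_one_power_expansion:
  fixes q :: real
  assumes "d \<le> n"
  shows "(q - 1) ^ d = (\<Sum>s\<le>n. (-1) powi (int d - int s) * (real d gchoose s) * q ^ s)"
proof -
  have "(q - 1) ^ d = (\<Sum>s\<le>d. real (d choose s) * q ^ s * (-1) ^ (d - s))"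
    using binomial_ring[of q "-1" d] by simp
  also have "\<dots> = (\<Sum>s\<le>d. (-1) powi (int d - int s) * (real d gchoose s) * q ^ s)"
    by (rule sum.cong) (auto simp: binomial_gbinomial power_int_def nat_diff_distrib)
  also have "\<dots> = (\<Sum>s\<le>n. (-1) powi (int d - int s) * (real d gchoose s) * q ^ s)"
    using assms by (intro sum.mono_neutral_left) (auto simp: binomial_gbinomial [symmetric])
  finally show ?thesis .
qed

theorem theorem3p1:
  fixes k t n s :: nat
  assumes "1 \<le> t" and "t \<le> k"
  shows "real (card {w \<in> words k n. lev {1..t} w = s}) =
    (\<Sum>m=0..n. \<Sum>i=0..m.
      (-1) powi (int n - int m - int s)
      * (real m gchoose i)
      * ((real i + real n - real m - 1) gchoose (n - m))
      * (real (n - m) gchoose s)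
      * (real k - real t) ^ (m - i) * real t ^ i)"
proof -
  define C where "C m i = (real m gchoose i) * ((real i + real n - real m - 1) gchoose (n - m))
      * (real k - real t) ^ (m - i) * real t ^ i" for m i
  define E where "E s m = (-1) powi (int n - int m - int s) * (real (n - m) gchoose s)" for s m
  define D where "D s = (\<Sum>m\<le>n. \<Sum>i\<le>m. C m i * E s m)" for s
  have "real (card {w \<in> words k n. lev {1..t} w = s}) = D s"
  proof (cases "s \<le> n")
    case True
    have "(\<Sum>s\<le>n. real (card {w \<in> words k n. lev {1..t} w = s}) * q ^ s) = (\<Sum>s\<le>n. D s * q ^ s)"
      for q :: real
    proof -
      have "(\<Sum>s\<le>n. real (card {w \<in> words k n. lev {1..t} w = s}) * q ^ s) =
          (\<Sum>m\<le>n. (block_fps (real k - real t) (real t) (q - 1) ^ m) $ (n - m))"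
        using assms by (simp add: lev_weight_eq_sum_card [symmetric] lev_weight_eq_block_fps)
      also have "\<dots> = (\<Sum>m\<le>n. \<Sum>i\<le>m. C m i * (q - 1) ^ (n - m))"
        by (intro sum.cong refl) (simp add: block_fps_power_nth C_def of_nat_diff algebra_simps)
      also have "\<dots> = (\<Sum>m\<le>n. \<Sum>i\<le>m. \<Sum>s\<le>n. C m i * E s m * q ^ s)"
      proof (intro sum.cong refl)
        fix m i assume "m \<in> {..n}"
        then show "C m i * (q - 1) ^ (n - m) = (\<Sum>s\<le>n. C m i * E s m * q ^ s)"
          by (simp add: minus_one_power_expansion[of "n - m" n] E_def sum_distrib_left of_nat_diff
              mult.assoc)
      qed
      also have "\<dots> = (\<Sum>m\<le>n. \<Sum>s\<le>n. \<Sum>i\<le>m. C m i * E s m * q ^ s)"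
        by (intro sum.cong refl sum.swap)
      also have "\<dots> = (\<Sum>s\<le>n. \<Sum>m\<le>n. \<Sum>i\<le>m. C m i * E s m * q ^ s)"
        by (rule sum.swap)
      finally show ?thesis by (simp add: D_def sum_distrib_right)
    qed
    \<comment> \<open>Polynomials in \<open>q\<close> that agree at every real have equal
      coefficients.\<close>
    then have "\<forall>s\<le>n. real (card {w \<in> words k n. lev {1..t} w = s}) = D s"
      by (intro polyfun_eq_coeffs [THEN iffD1] allI)
    then show ?thesis using True by blast
  next
    case False
    \<comment> \<open>A word of length \<open>n\<close> has at most \<open>n\<close> levels, and
      \<open>n - m\<close> over \<open>s\<close> is 0 for \<open>s > n\<close>.\<close>
    then have "{w \<in> words k n. lev {1..t} w = s} = {}"
      using lev_le_length by (auto simp: words_def)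
    moreover have "E s m = 0" for m
      using False by (simp add: E_def binomial_gbinomial [symmetric])
    ultimately show ?thesis by (simp only: D_def) simp
  qed
  then show ?thesis
    by (simp add: D_def C_def E_def atMost_atLeast0 mult_ac)
qed

end
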